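(* Let $\mathcal I$ be an ideal on a set $X$ and let $x\in X$. Let $\mathcal I_x=\{F\in\mathcal I\mid x\in F\}$ and let $j$ be the identity map of $\mathcal P(X)$. Then: (i) $j\restriction_{\mathcal I_x}$ is an asymorphism between the subballeans with support $\mathcal I_x$ of $X_{\mathcal I}^\flat$ and of $X_{\mathcal I\text{-}ary}^\flat$; (ii) $\mathbb M(X,\mathcal I)$ and, in particular, $X_{\mathcal I\text{-}ary}^\flat$ are coarsely equivalent to the subballean of $X_{\mathcal I}^\flat$ with support $\mathcal I_x$, witnessed by the map $$j\restriction_{\mathcal I_x}\colon X_{\mathcal I}^\flat\restriction_{\mathcal I_x}\to X_{\mathcal I\text{-}ary}^\flat\subseteq\mathbb M(X,\mathcal I)$$ (i.e., this map is a coarse equivalence both as a map into $\mathbb M(X,\mathcal I)$ and as a map into $X_{\mathcal I\text{-}ary}^\flat$).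
   Context: A ballean is a triple $\mathcal B=(X,P,B)$ where $X$ (the support) and $P\neq\emptyset$ (the radii set) are sets and $B\colon X\times P\to\mathcal P(X)$ is a map such that: $x\in B(x,\alpha)$ for all $x,\alpha$; $x\in B(y,\alpha)$ iff $y\in B(x,\alpha)$; for all $\alpha,\beta\in P$ there is $\gamma\in P$ with $B(B(x,\alpha),\beta)\subseteq B(x,\gamma)$ for all $x\in X$, where $B(A,\delta)=\bigcup_{y\in A}B(y,\delta)$. The subballean $\mathcal B\restriction_Y$ on $Y\subseteq X$ is $(Y,P,B_Y)$ with $B_Y(y,\alpha)=B(y,\alpha)\cap Y$. A subset $A\subseteq X$ is large in $X$ if $B(A,\alpha)=X$ for some $\alpha\in P$; it is bounded if there is $\alpha\in P$ with $A\subseteq B(y,\alpha)$ for every $y\in A$. A map $f\colon X\to Y$ between balleans $(X,P_X,B_X)$, $(Y,P_Y,B_Y)$ is: coarse if for every $\alpha\in P_X$ there is $\beta\in P_Y$ with $f(B_X(x,\alpha))\subseteq B_Y(f(x),\beta)$ for all $x\in X$; effectively proper if for every $\alpha\in P_Y$ there is $\beta\in P_X$ with $f^{-1}(B_Y(f(x),\alpha))\subseteq B_X(x,\beta)$ for all $x\in X$; a coarse embedding if it is both coarse and effectively proper; an asymorphism if it is bijective and both $f$ and $f^{-1}$ are coarse; a coarse equivalence if it is a coarse embedding and $f(X)$ is large in $Y$. An ideal $\mathcal I$ on $X$ is a family of subsets of $X$ closed under finite unions and subsets; it is always assumed that $X\notin\mathcal I$ and that $\mathcal I$ contains all finite subsets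 of $X$. The $\mathcal I$-ary ballean $X_{\mathcal I\text{-}ary}=(X,\mathcal I,B_{\mathcal I\text{-}ary})$ has balls $B_{\mathcal I\text{-}ary}(x,A)=\{x\}\cup A$. The point ideal ballean $X_{\mathcal I}=(X,\mathcal I,B_{\mathcal I})$ has balls $B_{\mathcal I}(x,A)=\{x\}$ if $x\notin A$ and $B_{\mathcal I}(x,A)=A$ if $x\in A$. The hyperballean of $\mathcal B=(X,P,B)$ is $\exp(\mathcal B)=(\mathcal P(X),P,\exp B)$, with $\exp B(A,\alpha)=\{C\in\mathcal P(X)\mid A\subseteq B(C,\alpha),\ C\subseteq B(A,\alpha)\}$; $\mathcal B^\flat$ is its subballean whose support is the family of all non-empty bounded subsets (for both $X_{\mathcal I}$ and $X_{\mathcal I\text{-}ary}$ the support of the $\flat$-ballean is $\mathcal I\setminus\{\emptyset\}$). The ballean $\mathbb C(X,\mathcal I)$ has support $\mathcal P(X)$ (identified with $\{0,1\}^X$ via characteristic functions), radii set $\mathcal I$ and balls $B_{\mathbb C}(A,K)=\{Y\subseteq X\mid A\setminus K\subseteq Y\subseteq A\cup K\}$. The $\mathcal I$-macrocube $\mathbb M(X,\mathcal I)$ is the subballean of $\mathbb C(X,\mathcal I)$ with support $\mathcal I$. *)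

theory Defs
  imports Main "HOL-Library.FuncSet"
begin

text \<open>
  A triple (X, P, B).  The axioms of a ballean are kept separate, in the predicate \<open>ballean\<close>:
  the triple defining the ideal-ary ballean below is not symmetric (see
  \<open>not_ballean_ary_ballean\<close>), although the hyperballeans built from it are balleans.
\<close>

record ('a, 'r) ball_structure =
  support :: "'a set"
  radii :: "'r set"
  balls :: "'a \<Rightarrow> 'r \<Rightarrow> 'a set"

definition set_ball :: "('a, 'r) ball_structure \<Rightarrow> 'a set \<Rightarrow> 'r \<Rightarrow> 'a set" where
  "set_ball \<B> A \<alpha> = (\<Union>y\<in>A. balls \<B> y \<alpha>)"

definition ballean :: "('a, 'r) ball_structure \<Rightarrow> bool" where
  "ballean \<B> \<longleftrightarrow>
     radii \<B> \<noteq> {} \<and>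
     (\<forall>x\<in>support \<B>. \<forall>\<alpha>\<in>radii \<B>. balls \<B> x \<alpha> \<subseteq> support \<B> \<and> x \<in> balls \<B> x \<alpha>) \<and>
     (\<forall>x\<in>support \<B>. \<forall>y\<in>support \<B>. \<forall>\<alpha>\<in>radii \<B>. x \<in> balls \<B> y \<alpha> \<longleftrightarrow> y \<in> balls \<B> x \<alpha>) \<and>
     (\<forall>\<alpha>\<in>radii \<B>. \<forall>\<beta>\<in>radii \<B>. \<exists>\<gamma>\<in>radii \<B>. \<forall>x\<in>support \<B>.
        set_ball \<B> (balls \<B> x \<alpha>) \<beta> \<subseteq> balls \<B> x \<gamma>)"

definition subballean :: "('a, 'r) ball_structure \<Rightarrow> 'a set \<Rightarrow> ('a, 'r) ball_structure" where
  "subballean \<B> Y = \<lparr>support = Y, radii = radii \<B>, balls = (\<lambda>y \<alpha>. balls \<B> y \<alpha> \<inter> Y)\<rparr>"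

definition large_in :: "('a, 'r) ball_structure \<Rightarrow> 'a set \<Rightarrow> bool" where
  "large_in \<B> A \<longleftrightarrow> A \<subseteq> support \<B> \<and> (\<exists>\<alpha>\<in>radii \<B>. set_ball \<B> A \<alpha> = support \<B>)"

definition bounded_in :: "('a, 'r) ball_structure \<Rightarrow> 'a set \<Rightarrow> bool" where
  "bounded_in \<B> A \<longleftrightarrow> A \<subseteq> support \<B> \<and> (\<exists>\<alpha>\<in>radii \<B>. \<forall>y\<in>A. A \<subseteq> balls \<B> y \<alpha>)"

definition coarse ::
    "('a, 'r) ball_structure \<Rightarrow> ('b, 's) ball_structure \<Rightarrow> ('a \<Rightarrow> 'b) \<Rightarrow> bool" where
  "coarse \<X> \<Y> f \<longleftrightarrow>
     f \<in> support \<X> \<rightarrow> support \<Y> \<and>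
     (\<forall>\<alpha>\<in>radii \<X>. \<exists>\<beta>\<in>radii \<Y>. \<forall>x\<in>support \<X>. f ` balls \<X> x \<alpha> \<subseteq> balls \<Y> (f x) \<beta>)"

definition effectively_proper ::
    "('a, 'r) ball_structure \<Rightarrow> ('b, 's) ball_structure \<Rightarrow> ('a \<Rightarrow> 'b) \<Rightarrow> bool" where
  "effectively_proper \<X> \<Y> f \<longleftrightarrow>
     f \<in> support \<X> \<rightarrow> support \<Y> \<and>
     (\<forall>\<alpha>\<in>radii \<Y>. \<exists>\<beta>\<in>radii \<X>. \<forall>x\<in>support \<X>.
        f -` balls \<Y> (f x) \<alpha> \<inter> support \<X> \<subseteq> balls \<X> x \<beta>)"

definition coarse_embedding ::
    "('a, 'r) ball_structure \<Rightarrow> ('b, 's) ball_structure \<Rightarrow> ('a \<Rightarrow> 'b) \<Rightarrow> bool" where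
  "coarse_embedding \<X> \<Y> f \<longleftrightarrow> coarse \<X> \<Y> f \<and> effectively_proper \<X> \<Y> f"

definition asymorphism ::
    "('a, 'r) ball_structure \<Rightarrow> ('b, 's) ball_structure \<Rightarrow> ('a \<Rightarrow> 'b) \<Rightarrow> bool" where
  "asymorphism \<X> \<Y> f \<longleftrightarrow>
     bij_betw f (support \<X>) (support \<Y>) \<and>
     coarse \<X> \<Y> f \<and> coarse \<Y> \<X> (inv_into (support \<X>) f)"

definition coarse_equivalence ::
    "('a, 'r) ball_structure \<Rightarrow> ('b, 's) ball_structure \<Rightarrow> ('a \<Rightarrow> 'b) \<Rightarrow> bool" where
  "coarse_equivalence \<X> \<Y> f \<longleftrightarrow>
     coarse_embedding \<X> \<Y> f \<and> large_in \<Y> (f ` support \<X>)"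

definition set_ideal :: "'a set \<Rightarrow> 'a set set \<Rightarrow> bool" where
  "set_ideal X \<I> \<longleftrightarrow>
     \<I> \<subseteq> Pow X \<and>
     (\<forall>A\<in>\<I>. \<forall>B\<in>\<I>. A \<union> B \<in> \<I>) \<and>
     (\<forall>A\<in>\<I>. \<forall>B. B \<subseteq> A \<longrightarrow> B \<in> \<I>) \<and>
     X \<notin> \<I> \<and>
     (\<forall>A. A \<subseteq> X \<and> finite A \<longrightarrow> A \<in> \<I>)"

definition ary_ballean :: "'a set \<Rightarrow> 'a set set \<Rightarrow> ('a, 'a set) ball_structure" where
  "ary_ballean X \<I> = \<lparr>support = X, radii = \<I>, balls = (\<lambda>x A. {x} \<union> A)\<rparr>"

definition point_ballean :: "'a set \<Rightarrow> 'a set set \<Rightarrow> ('a, 'a set) ball_structure" where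
  "point_ballean X \<I> =
     \<lparr>support = X, radii = \<I>, balls = (\<lambda>x A. if x \<in> A then A else {x})\<rparr>"

definition hyperballean :: "('a, 'r) ball_structure \<Rightarrow> ('a set, 'r) ball_structure" where
  "hyperballean \<B> =
     \<lparr>support = Pow (support \<B>), radii = radii \<B>,
      balls = (\<lambda>A \<alpha>. {C \<in> Pow (support \<B>). A \<subseteq> set_ball \<B> C \<alpha> \<and> C \<subseteq> set_ball \<B> A \<alpha>})\<rparr>"

definition flat_ballean :: "('a, 'r) ball_structure \<Rightarrow> ('a set, 'r) ball_structure" where
  "flat_ballean \<B> = subballean (hyperballean \<B>) {A. A \<noteq> {} \<and> bounded_in \<B> A}"

definition cube_ballean :: "'a set \<Rightarrow> 'a set set \<Rightarrow> ('a set, 'a set) ball_structure" where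
  "cube_ballean X \<I> =
     \<lparr>support = Pow X, radii = \<I>, balls = (\<lambda>A K. {Y. Y \<subseteq> X \<and> A - K \<subseteq> Y \<and> Y \<subseteq> A \<union> K})\<rparr>"

definition macrocube :: "'a set \<Rightarrow> 'a set set \<Rightarrow> ('a set, 'a set) ball_structure" where
  "macrocube X \<I> = subballean (cube_ballean X \<I>) \<I>"

definition ideal_at :: "'a set set \<Rightarrow> 'a \<Rightarrow> 'a set set" where
  "ideal_at \<I> x = {F \<in> \<I>. x \<in> F}"

lemma not_ballean_ary_ballean:
  assumes "set_ideal X \<I>"
  shows "\<not> ballean (ary_ballean X \<I>)"
proof
  assume b: "ballean (ary_ballean X \<I>)"
  have "{} \<in> \<I>" "X \<notin> \<I>" using assms by (auto simp: set_ideal_def)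
  then have "X \<noteq> {}" by blast
  then obtain x where x: "x \<in> X" by blast
  then have sx: "{x} \<in> \<I>" using assms by (auto simp: set_ideal_def)
  with \<open>X \<notin> \<I>\<close> x have "X \<noteq> {x}" by blast
  with x obtain y where y: "y \<in> X" "y \<noteq> x" by blast
  from b have "\<forall>x\<in>X. \<forall>y\<in>X. \<forall>A\<in>\<I>. x \<in> {y} \<union> A \<longleftrightarrow> y \<in> {x} \<union> A"
    unfolding ballean_def ary_ballean_def by simp
  with x y(1) sx have "x \<in> {y} \<union> {x} \<longleftrightarrow> y \<in> {x} \<union> {x}" by blast
  with y(2) show False by simp
qed

lemma ballean_point_ballean:
  assumes "set_ideal X \<I>"
  shows "ballean (point_ballean X \<I>)"
proof -
  have "\<exists>\<gamma>\<in>\<I>. \<forall>x\<in>X. set_ball (point_ballean X \<I>) (if x \<in> A then A else {x}) B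
          \<subseteq> (if x \<in> \<gamma> then \<gamma> else {x})" if "A \<in> \<I>" "B \<in> \<I>" for A B
  proof (rule bexI)
    show "A \<union> B \<in> \<I>" using that assms by (simp add: set_ideal_def)
    show "\<forall>x\<in>X. set_ball (point_ballean X \<I>) (if x \<in> A then A else {x}) B
          \<subseteq> (if x \<in> A \<union> B then A \<union> B else {x})"
      by (auto simp: set_ball_def point_ballean_def split: if_splits)
  qed
  moreover have "{} \<in> \<I>" using assms by (auto simp: set_ideal_def)
  moreover have "A \<subseteq> X" if "A \<in> \<I>" for A using assms that unfolding set_ideal_def by blast
  ultimately show ?thesis
    unfolding ballean_def by (simp add: point_ballean_def) blast
qed

lemma ballean_cube_ballean:
  assumes "set_ideal X \<I>"
  shows "ballean (cube_ballean X \<I>)"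
proof -
  have "\<exists>\<gamma>\<in>\<I>. \<forall>A\<in>Pow X. set_ball (cube_ballean X \<I>) {Y. Y \<subseteq> X \<and> A - K \<subseteq> Y \<and> Y \<subseteq> A \<union> K} L
          \<subseteq> {Y. Y \<subseteq> X \<and> A - \<gamma> \<subseteq> Y \<and> Y \<subseteq> A \<union> \<gamma>}" if "K \<in> \<I>" "L \<in> \<I>" for K L
  proof (rule bexI)
    show "K \<union> L \<in> \<I>" using that assms by (simp add: set_ideal_def)
    show "\<forall>A\<in>Pow X. set_ball (cube_ballean X \<I>) {Y. Y \<subseteq> X \<and> A - K \<subseteq> Y \<and> Y \<subseteq> A \<union> K} L
          \<subseteq> {Y. Y \<subseteq> X \<and> A - (K \<union> L) \<subseteq> Y \<and> Y \<subseteq> A \<union> (K \<union> L)}"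
      unfolding set_ball_def cube_ballean_def by simp blast
  qed
  moreover have "{} \<in> \<I>" using assms by (auto simp: set_ideal_def)
  ultimately show ?thesis
    unfolding ballean_def by (auto simp: cube_ballean_def)
qed

lemma ballean_subballean:
  assumes "ballean \<B>" "Y \<subseteq> support \<B>"
  shows "ballean (subballean \<B> Y)"
proof -
  have "\<exists>\<gamma>\<in>radii \<B>. \<forall>x\<in>Y. set_ball (subballean \<B> Y) (balls \<B> x \<alpha> \<inter> Y) \<beta> \<subseteq> balls \<B> x \<gamma> \<inter> Y"
    if ab: "\<alpha> \<in> radii \<B>" "\<beta> \<in> radii \<B>" for \<alpha> \<beta>
  proof -
    obtain \<gamma> where "\<gamma> \<in> radii \<B>"
      "\<forall>x\<in>support \<B>. set_ball \<B> (balls \<B> x \<alpha>) \<beta> \<subseteq> balls \<B> x \<gamma>"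
      using assms(1) ab unfolding ballean_def by blast
    then show ?thesis
      using assms(2) by (intro bexI[of _ \<gamma>]) (fastforce simp: set_ball_def subballean_def)+
  qed
  then show ?thesis
    using assms unfolding ballean_def by (auto simp: subballean_def subset_iff)
qed

lemma bounded_in_point_ballean:
  assumes "set_ideal X \<I>"
  shows "bounded_in (point_ballean X \<I>) A \<longleftrightarrow> A \<in> \<I>"
proof
  assume "bounded_in (point_ballean X \<I>) A"
  then obtain K where K: "A \<subseteq> X" "K \<in> \<I>" "\<forall>y\<in>A. A \<subseteq> (if y \<in> K then K else {y})"
    unfolding bounded_in_def point_ballean_def by auto
  show "A \<in> \<I>"
  proof (cases "A \<subseteq> K")
    case True
    with K(2) assms show ?thesis by (auto simp: set_ideal_def)
  next
    case False
    with K(3) obtain y where "A \<subseteq> {y}" by (metis subsetI)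
    with K(1) finite_subset[of A "{y}"] assms show ?thesis by (auto simp: set_ideal_def)
  qed
next
  assume "A \<in> \<I>"
  with assms show "bounded_in (point_ballean X \<I>) A"
    by (auto simp: bounded_in_def point_ballean_def set_ideal_def)
qed

lemma bounded_in_ary_ballean:
  assumes "set_ideal X \<I>"
  shows "bounded_in (ary_ballean X \<I>) A \<longleftrightarrow> A \<in> \<I>"
proof
  assume "bounded_in (ary_ballean X \<I>) A"
  then obtain K where K: "A \<subseteq> X" "K \<in> \<I>" "\<forall>y\<in>A. A \<subseteq> {y} \<union> K"
    unfolding bounded_in_def ary_ballean_def by auto
  show "A \<in> \<I>"
  proof (cases "A = {}")
    case True
    with assms show ?thesis by (simp add: set_ideal_def)
  next
    case False
    with K(1,3) obtain y where y: "y \<in> X" "A \<subseteq> {y} \<union> K" by blast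
    then have "{y} \<in> \<I>" using assms by (simp add: set_ideal_def)
    with K(2) assms have "{y} \<union> K \<in> \<I>" unfolding set_ideal_def by blast
    with y(2) assms show ?thesis unfolding set_ideal_def by blast
  qed
next
  assume "A \<in> \<I>"
  with assms show "bounded_in (ary_ballean X \<I>) A"
    by (auto simp: bounded_in_def ary_ballean_def set_ideal_def)
qed

lemma set_ball_mono: "A \<subseteq> A' \<Longrightarrow> set_ball \<B> A \<alpha> \<subseteq> set_ball \<B> A' \<alpha>"
  by (auto simp: set_ball_def)

lemma set_ball_set_ball:
  "set_ball \<B> (set_ball \<B> A \<alpha>) \<beta> = (\<Union>x\<in>A. set_ball \<B> (balls \<B> x \<alpha>) \<beta>)"
  by (auto simp: set_ball_def)

lemma ballean_hyperballean:
  assumes "ballean \<B>"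
  shows "ballean (hyperballean \<B>)"
proof -
  have "\<exists>\<gamma>\<in>radii \<B>. \<forall>A\<in>Pow (support \<B>).
          set_ball (hyperballean \<B>) (balls (hyperballean \<B>) A \<alpha>) \<beta> \<subseteq> balls (hyperballean \<B>) A \<gamma>"
    if ab: "\<alpha> \<in> radii \<B>" "\<beta> \<in> radii \<B>" for \<alpha> \<beta>
  proof -
    obtain \<gamma> where g: "\<gamma> \<in> radii \<B>"
      "\<forall>x\<in>support \<B>. set_ball \<B> (balls \<B> x \<alpha>) \<beta> \<subseteq> balls \<B> x \<gamma>"
      using assms ab unfolding ballean_def by blast
    obtain \<delta> where d: "\<delta> \<in> radii \<B>"
      "\<forall>x\<in>support \<B>. set_ball \<B> (balls \<B> x \<beta>) \<alpha> \<subseteq> balls \<B> x \<delta>"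
      using assms ab unfolding ballean_def by blast
    obtain \<epsilon> where e: "\<epsilon> \<in> radii \<B>"
      "\<forall>x\<in>support \<B>. set_ball \<B> (balls \<B> x \<gamma>) \<delta> \<subseteq> balls \<B> x \<epsilon>"
      using assms g(1) d(1) unfolding ballean_def by blast
    have refl: "x \<in> balls \<B> x \<eta>" "balls \<B> x \<eta> \<subseteq> support \<B>"
      if "x \<in> support \<B>" "\<eta> \<in> radii \<B>" for x \<eta>
      using assms that unfolding ballean_def by auto
    have ge: "balls \<B> x \<gamma> \<subseteq> balls \<B> x \<epsilon>" if "x \<in> support \<B>" for x
      using e(2) refl[OF that g(1)] refl(1)[OF _ d(1)] that unfolding set_ball_def by blast
    have de: "balls \<B> x \<delta> \<subseteq> balls \<B> x \<epsilon>" if "x \<in> support \<B>" for x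
      using e(2) refl[OF that g(1)] that unfolding set_ball_def by blast
    have "D \<in> balls (hyperballean \<B>) A \<epsilon>"
      if A: "A \<subseteq> support \<B>" and C: "C \<in> balls (hyperballean \<B>) A \<alpha>"
        and D: "D \<in> balls (hyperballean \<B>) C \<beta>" for A C D
    proof -
      have s: "C \<subseteq> support \<B>" "D \<subseteq> support \<B>"
        and AC: "A \<subseteq> set_ball \<B> C \<alpha>" "C \<subseteq> set_ball \<B> A \<alpha>"
        and CD: "C \<subseteq> set_ball \<B> D \<beta>" "D \<subseteq> set_ball \<B> C \<beta>"
        using C D by (auto simp: hyperballean_def)
      have "D \<subseteq> (\<Union>x\<in>A. set_ball \<B> (balls \<B> x \<alpha>) \<beta>)"
        using CD(2) set_ball_mono[OF AC(2), of \<B> \<beta>] unfolding set_ball_set_ball by (rule order_trans)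
      also have "\<dots> \<subseteq> set_ball \<B> A \<gamma>"
        unfolding set_ball_def[of _ A] using g(2) A by (intro UN_mono) auto
      also have "set_ball \<B> A \<gamma> \<subseteq> set_ball \<B> A \<epsilon>"
        unfolding set_ball_def using ge A by (intro UN_mono) auto
      finally have 1: "D \<subseteq> set_ball \<B> A \<epsilon>" .
      have "A \<subseteq> (\<Union>x\<in>D. set_ball \<B> (balls \<B> x \<beta>) \<alpha>)"
        using AC(1) set_ball_mono[OF CD(1), of \<B> \<alpha>] unfolding set_ball_set_ball by (rule order_trans)
      also have "\<dots> \<subseteq> set_ball \<B> D \<delta>"
        unfolding set_ball_def[of _ D] using d(2) s(2) by (intro UN_mono) auto
      also have "set_ball \<B> D \<delta> \<subseteq> set_ball \<B> D \<epsilon>"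
        unfolding set_ball_def using de s(2) by (intro UN_mono) auto
      finally have 2: "A \<subseteq> set_ball \<B> D \<epsilon>" .
      show ?thesis using 1 2 s by (simp add: hyperballean_def)
    qed
    then show ?thesis
      using e(1) by (intro bexI[of _ \<epsilon>]) (auto simp: set_ball_def[of "hyperballean \<B>"])
  qed
  moreover have "A \<subseteq> set_ball \<B> A \<alpha>" if "A \<subseteq> support \<B>" "\<alpha> \<in> radii \<B>" for A \<alpha>
    using assms that unfolding ballean_def set_ball_def by blast
  ultimately show ?thesis
    using assms unfolding ballean_def by (simp add: hyperballean_def) auto
qed

lemma ballean_flat_point_ballean:
  "set_ideal X \<I> \<Longrightarrow> ballean (flat_ballean (point_ballean X \<I>))"
  unfolding flat_ballean_def
  by (intro ballean_subballean ballean_hyperballean ballean_point_ballean)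
     (auto simp: hyperballean_def bounded_in_def)

lemma ballean_macrocube:
  "set_ideal X \<I> \<Longrightarrow> ballean (macrocube X \<I>)"
  unfolding macrocube_def
  by (intro ballean_subballean ballean_cube_ballean) (auto simp: cube_ballean_def set_ideal_def)

lemma support_flat_point_ballean:
  "set_ideal X \<I> \<Longrightarrow> support (flat_ballean (point_ballean X \<I>)) = \<I> - {{}}"
  by (auto simp: flat_ballean_def subballean_def bounded_in_point_ballean)

lemma support_flat_ary_ballean:
  "set_ideal X \<I> \<Longrightarrow> support (flat_ballean (ary_ballean X \<I>)) = \<I> - {{}}"
  by (auto simp: flat_ballean_def subballean_def bounded_in_ary_ballean)

text \<open>
  On non-empty members of the ideal, the balls of the flat ballean of the ideal-ary ballean are
  those of the subballean of the macrocube with support \<open>\<I> - {{}}\<close>.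
\<close>

lemma balls_flat_ary_ballean:
  assumes "set_ideal X \<I>" "A \<in> \<I> - {{}}"
  shows "balls (flat_ballean (ary_ballean X \<I>)) A K = balls (subballean (macrocube X \<I>) (\<I> - {{}})) A K"
proof -
  let ?B = "ary_ballean X \<I>" and ?J = "\<I> - {{}}"
  have sb: "set_ball ?B C K = C \<union> K" if "C \<in> ?J" for C
    using that by (auto simp: set_ball_def ary_ballean_def)
  have J: "{A. A \<noteq> {} \<and> bounded_in ?B A} = ?J"
    using bounded_in_ary_ballean[OF assms(1)] by auto
  have "balls (flat_ballean ?B) A K
      = {C \<in> ?J. C \<subseteq> X \<and> A \<subseteq> set_ball ?B C K \<and> C \<subseteq> set_ball ?B A K}"
    unfolding flat_ballean_def J by (auto simp: subballean_def hyperballean_def ary_ballean_def)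
  also have "\<dots> = {C \<in> ?J. C \<subseteq> X \<and> A - K \<subseteq> C \<and> C \<subseteq> A \<union> K}"
    using sb assms(2) by (intro Collect_cong) (metis Diff_subset_conv Un_commute)
  also have "\<dots> = balls (subballean (macrocube X \<I>) ?J) A K"
    by (auto simp: subballean_def macrocube_def cube_ballean_def)
  finally show ?thesis .
qed

lemma ballean_flat_ary_ballean:
  assumes "set_ideal X \<I>"
  shows "ballean (flat_ballean (ary_ballean X \<I>))"
proof -
  let ?M = "subballean (macrocube X \<I>) (\<I> - {{}})" and ?F = "flat_ballean (ary_ballean X \<I>)"
  have M: "ballean ?M"
    using assms by (intro ballean_subballean ballean_macrocube) (auto simp: macrocube_def subballean_def)
  have s: "support ?F = support ?M" "radii ?F = radii ?M"
    using support_flat_ary_ballean[OF assms]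
    by (auto simp: flat_ballean_def subballean_def hyperballean_def macrocube_def cube_ballean_def
        ary_ballean_def)
  have b: "balls ?F A K = balls ?M A K" if "A \<in> support ?M" for A K
    using balls_flat_ary_ballean[OF assms] that by (simp add: subballean_def)
  have sub: "balls ?M A K \<subseteq> support ?M" for A K
    by (auto simp: subballean_def)
  have sb: "set_ball ?F (balls ?M A K) L = set_ball ?M (balls ?M A K) L" for A K L
    using sub unfolding set_ball_def by (intro SUP_cong refl b) blast
  show ?thesis
    using M unfolding ballean_def by (simp add: s b sb cong: ball_cong)
qed

end

(* In the point ideal ballean the K-ball around a set A is the union of A and K if A meets K, and A
   itself otherwise. Hence every ball of the flat point ideal ballean lies in the cube ball of the
   same radius, and on sets containing x the two coincide for radii containing x; enlarging K to
   insert x K therefore gives effective properness. Adding x to a set moves it within radius {x},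
   so the sets containing x form a large family. *)

theory Submission
  imports Defs
begin

lemma support_subballean [simp]: "support (subballean \<B> Y) = Y"
  and radii_subballean [simp]: "radii (subballean \<B> Y) = radii \<B>"
  and balls_subballean [simp]: "balls (subballean \<B> Y) y \<alpha> = balls \<B> y \<alpha> \<inter> Y"
  by (simp_all add: subballean_def)

lemma radii_flat_ballean [simp]: "radii (flat_ballean \<B>) = radii \<B>"
  by (simp add: flat_ballean_def hyperballean_def)

lemma radii_point_ballean [simp]: "radii (point_ballean X \<I>) = \<I>"
  by (simp add: point_ballean_def)

lemma radii_ary_ballean [simp]: "radii (ary_ballean X \<I>) = \<I>"
  by (simp add: ary_ballean_def)

lemma support_macrocube [simp]: "support (macrocube X \<I>) = \<I>"
  and radii_macrocube [simp]: "radii (macrocube X \<I>) = \<I>"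
  by (simp_all add: macrocube_def cube_ballean_def)

lemma balls_macrocube:
  assumes "set_ideal X \<I>"
  shows "balls (macrocube X \<I>) A K = {C \<in> \<I>. A - K \<subseteq> C \<and> C \<subseteq> A \<union> K}"
  using assms by (auto simp: macrocube_def cube_ballean_def set_ideal_def)

lemma set_ideal_insert:
  assumes "set_ideal X \<I>" "x \<in> X" "A \<in> \<I>"
  shows "insert x A \<in> \<I>"
proof -
  have "{x} \<in> \<I>" using assms by (simp add: set_ideal_def)
  then have "{x} \<union> A \<in> \<I>" using assms unfolding set_ideal_def by blast
  then show ?thesis by simp
qed

lemma set_ball_point_ballean:
  "set_ball (point_ballean X \<I>) A K = (if A \<inter> K = {} then A else A \<union> K)"
  by (auto simp: set_ball_def point_ballean_def)

text \<open>Bounded sets are exactly the members of the ideal, and these already lie in X, so the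
  power-set and boundedness conditions reduce to membership in \<open>\<I> - {{}}\<close>.\<close>

lemma balls_flat_point_ballean:
  assumes "set_ideal X \<I>"
  shows "balls (flat_ballean (point_ballean X \<I>)) A K =
    {C \<in> \<I> - {{}}. A \<subseteq> set_ball (point_ballean X \<I>) C K \<and> C \<subseteq> set_ball (point_ballean X \<I>) A K}"
proof -
  have "{A. A \<noteq> {} \<and> bounded_in (point_ballean X \<I>) A} = \<I> - {{}}"
    using bounded_in_point_ballean[OF assms] by auto
  moreover have "C \<subseteq> support (point_ballean X \<I>)" if "C \<in> \<I>" for C
    using that assms by (auto simp: set_ideal_def point_ballean_def)
  ultimately show ?thesis by (auto simp: flat_ballean_def hyperballean_def)
qed

text \<open>Both values of \<open>set_ball (point_ballean X \<I>) C K\<close> lie in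
  \<open>C \<union> K\<close>, and \<open>A \<subseteq> C \<union> K\<close> says the same as
  \<open>A - K \<subseteq> C\<close>.\<close>

lemma balls_flat_point_subset_macrocube:
  assumes "set_ideal X \<I>"
  shows "balls (flat_ballean (point_ballean X \<I>)) A K \<subseteq> balls (macrocube X \<I>) A K"
  using assms
  by (auto simp: balls_flat_point_ballean balls_macrocube set_ball_point_ballean split: if_splits)

text \<open>The centre and the members on the left all contain x, so each meets
  \<open>insert x K\<close>; their point-ideal balls of that radius are therefore full unions, which
  include the unions with K.\<close>

lemma balls_macrocube_subset_flat_point:
  assumes "set_ideal X \<I>" "A \<in> ideal_at \<I> x"
  shows "balls (macrocube X \<I>) A K \<inter> ideal_at \<I> x
    \<subseteq> balls (flat_ballean (point_ballean X \<I>)) A (insert x K)"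
  using assms
  by (auto simp: balls_flat_point_ballean balls_macrocube set_ball_point_ballean ideal_at_def)

text \<open>Effective properness of a bijection is coarseness of its inverse. The hypothesis
  \<open>sub\<close> is there because a bare \<open>ball_structure\<close> may have balls leaving
  the support, where \<open>inv_into\<close> is uncontrolled.\<close>

lemma asymorphism_if_bij_coarse_embedding:
  assumes bij: "bij_betw f (support \<X>) (support \<Y>)"
    and emb: "coarse_embedding \<X> \<Y> f"
    and sub: "\<And>y \<alpha>. y \<in> support \<Y> \<Longrightarrow> \<alpha> \<in> radii \<Y> \<Longrightarrow> balls \<Y> y \<alpha> \<subseteq> support \<Y>"
  shows "asymorphism \<X> \<Y> f"
proof -
  let ?g = "inv_into (support \<X>) f"
  have g: "?g y \<in> support \<X>" "f (?g y) = y" if "y \<in> support \<Y>" for y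
    using bij that bij_betw_imp_surj_on[OF bij] by (auto simp: inv_into_into f_inv_into_f)
  have "\<exists>\<beta>\<in>radii \<X>. \<forall>y\<in>support \<Y>. ?g ` balls \<Y> y \<alpha> \<subseteq> balls \<X> (?g y) \<beta>"
    if \<alpha>: "\<alpha> \<in> radii \<Y>" for \<alpha>
  proof -
    obtain \<beta> where \<beta>: "\<beta> \<in> radii \<X>"
      "\<And>z. z \<in> support \<X> \<Longrightarrow> f -` balls \<Y> (f z) \<alpha> \<inter> support \<X> \<subseteq> balls \<X> z \<beta>"
      using emb \<alpha> unfolding coarse_embedding_def effectively_proper_def by blast
    have "?g w \<in> balls \<X> (?g y) \<beta>" if "y \<in> support \<Y>" "w \<in> balls \<Y> y \<alpha>" for y w
    proof -
      \<comment> \<open>Membership in the support gives \<open>f (?g w) = w\<close>, so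
        \<open>?g w\<close> lies in the preimage of the ball around
        \<open>f (?g y) = y\<close>.\<close>
      have "w \<in> support \<Y>" using that sub \<alpha> by blast
      then show ?thesis using \<beta>(2)[of "?g y"] g that by auto
    qed
    with \<beta>(1) show ?thesis by blast
  qed
  with g(1) have "coarse \<Y> \<X> ?g" unfolding coarse_def by blast
  with bij emb show ?thesis by (simp add: asymorphism_def coarse_embedding_def)
qed

text \<open>Here \<open>\<Y>\<close> is left abstract to cover three targets: the macrocube, the
  flat ideal-ary ballean and its subballean on \<open>ideal_at \<I> x\<close>. Balls are compared
  only within \<open>ideal_at \<I> x\<close>, since the map never leaves it.\<close>

lemma coarse_embedding_ideal_at:
  assumes I: "set_ideal X \<I>" "x \<in> X"
    and Y: "ideal_at \<I> x \<subseteq> support \<Y>" "radii \<Y> = \<I>"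
    and balls: "\<And>A K. A \<in> ideal_at \<I> x \<Longrightarrow> K \<in> \<I> \<Longrightarrow>
      balls \<Y> A K \<inter> ideal_at \<I> x = balls (macrocube X \<I>) A K \<inter> ideal_at \<I> x"
  shows "coarse_embedding (subballean (flat_ballean (point_ballean X \<I>)) (ideal_at \<I> x)) \<Y>
    (restrict id (ideal_at \<I> x))"
proof -
  let ?J = "ideal_at \<I> x" and ?P = "flat_ballean (point_ballean X \<I>)"
  let ?j = "restrict id ?J"
  have j: "?j \<in> ?J \<rightarrow> support \<Y>" using Y(1) by auto
  \<comment> \<open>Coarseness keeps the radius K; only the converse direction below must enlarge
    it.\<close>
  have 1: "?j ` (balls ?P A K \<inter> ?J) \<subseteq> balls \<Y> (?j A) K" if "A \<in> ?J" "K \<in> \<I>" for A K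
    using balls[OF that] balls_flat_point_subset_macrocube[OF I(1), of A K] that(1) by auto
  have 2: "?j -` balls \<Y> (?j A) K \<inter> ?J \<subseteq> balls ?P A (insert x K) \<inter> ?J"
    if "A \<in> ?J" "K \<in> \<I>" for A K
    using balls[OF that] balls_macrocube_subset_flat_point[OF I(1) that(1), of K] that(1) by auto
  have "coarse (subballean ?P ?J) \<Y> ?j"
    unfolding coarse_def using j 1 Y(2) by (intro conjI ballI bexI) simp_all
  moreover have "effectively_proper (subballean ?P ?J) \<Y> ?j"
    unfolding effectively_proper_def
  proof (intro conjI ballI)
    fix K assume "K \<in> radii \<Y>"
    then have "K \<in> \<I>" using Y(2) by simp
    then show "\<exists>L\<in>radii (subballean ?P ?J). \<forall>A\<in>support (subballean ?P ?J).
        ?j -` balls \<Y> (?j A) K \<inter> support (subballean ?P ?J) \<subseteq> balls (subballean ?P ?J) A L"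
      using 2 set_ideal_insert[OF I] by (intro bexI[of _ "insert x K"]) simp_all
  qed (use j in simp)
  ultimately show ?thesis by (simp add: coarse_embedding_def)
qed

text \<open>The centres still contain x, but the sets to be covered need not, so the balls must now
  agree with cube balls on all of \<open>support \<Y>\<close>.\<close>

lemma large_in_ideal_at:
  assumes I: "set_ideal X \<I>" "x \<in> X"
    and Y: "ideal_at \<I> x \<subseteq> support \<Y>" "support \<Y> \<subseteq> \<I>" "radii \<Y> = \<I>"
    and balls: "\<And>A K. A \<in> ideal_at \<I> x \<Longrightarrow> K \<in> \<I> \<Longrightarrow>
      balls \<Y> A K = balls (macrocube X \<I>) A K \<inter> support \<Y>"
  shows "large_in \<Y> (ideal_at \<I> x)"
proof -
  have x: "{x} \<in> \<I>" using I by (simp add: set_ideal_def)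
  have "A \<in> set_ball \<Y> (ideal_at \<I> x) {x}" if "A \<in> support \<Y>" for A
  proof -
    have "A \<in> \<I>" using that Y(2) by blast
    then have "insert x A \<in> ideal_at \<I> x" using set_ideal_insert[OF I] by (simp add: ideal_at_def)
    \<comment> \<open>The cube condition reads \<open>insert x A - {x} \<subseteq> A\<close> and
      \<open>A \<subseteq> insert x A \<union> {x}\<close>, whether or not x belongs to A.\<close>
    moreover from this have "A \<in> balls \<Y> (insert x A) {x}"
      using that \<open>A \<in> \<I>\<close> x by (auto simp: balls balls_macrocube[OF I(1)])
    ultimately show ?thesis by (auto simp: set_ball_def)
  qed
  moreover have "set_ball \<Y> (ideal_at \<I> x) {x} \<subseteq> support \<Y>"
    using balls x by (auto simp: set_ball_def)
  ultimately show ?thesis using Y x by (auto simp: large_in_def)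
qed

theorem corollary3p4:
  fixes X :: "'a set" and \<I> :: "'a set set" and x :: 'a
  assumes "set_ideal X \<I>" and "x \<in> X"
  shows "asymorphism
           (subballean (flat_ballean (point_ballean X \<I>)) (ideal_at \<I> x))
           (subballean (flat_ballean (ary_ballean X \<I>)) (ideal_at \<I> x))
           (restrict id (ideal_at \<I> x)) \<and>
         coarse_equivalence
           (subballean (flat_ballean (point_ballean X \<I>)) (ideal_at \<I> x))
           (macrocube X \<I>)
           (restrict id (ideal_at \<I> x)) \<and>
         coarse_equivalence
           (subballean (flat_ballean (point_ballean X \<I>)) (ideal_at \<I> x))
           (flat_ballean (ary_ballean X \<I>))
           (restrict id (ideal_at \<I> x))"
proof -
  let ?J = "ideal_at \<I> x" and ?A = "flat_ballean (ary_ballean X \<I>)"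
  have J: "?J \<subseteq> \<I>" "?J \<subseteq> \<I> - {{}}" by (auto simp: ideal_at_def)
  have supp: "support ?A = \<I> - {{}}" by (rule support_flat_ary_ballean[OF assms(1)])
  \<comment> \<open>A centre containing x is non-empty, so \<open>balls_flat_ary_ballean\<close>
    applies. Intersecting further with \<open>?J\<close> absorbs \<open>\<I> - {{}}\<close>, which
    is the form the embedding lemma asks for.\<close>
  have ary: "balls ?A B K = balls (macrocube X \<I>) B K \<inter> (\<I> - {{}})" if "B \<in> ?J" for B K
    using that J(2) balls_flat_ary_ballean[OF assms(1)] by auto
  have "asymorphism (subballean (flat_ballean (point_ballean X \<I>)) ?J) (subballean ?A ?J)
      (restrict id ?J)"
  proof (rule asymorphism_if_bij_coarse_embedding)
    show "bij_betw (restrict id ?J) (support (subballean (flat_ballean (point_ballean X \<I>)) ?J))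
        (support (subballean ?A ?J))"
      by (simp add: bij_betw_def inj_on_def)
    show "coarse_embedding (subballean (flat_ballean (point_ballean X \<I>)) ?J) (subballean ?A ?J)
        (restrict id ?J)"
      by (rule coarse_embedding_ideal_at[OF assms]) (use J ary in auto)
  \<comment> \<open>What remains is that balls stay in the support, which holds in a subballean by
    construction.\<close>
  qed simp
  moreover have "coarse_equivalence (subballean (flat_ballean (point_ballean X \<I>)) ?J)
      (macrocube X \<I>) (restrict id ?J)"
    unfolding coarse_equivalence_def
  proof
    show "coarse_embedding (subballean (flat_ballean (point_ballean X \<I>)) ?J) (macrocube X \<I>)
        (restrict id ?J)"
      by (rule coarse_embedding_ideal_at[OF assms]) (use J in auto)
    have "large_in (macrocube X \<I>) ?J"
      by (rule large_in_ideal_at[OF assms]) (use J balls_macrocube[OF assms(1)] in auto)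
    then show "large_in (macrocube X \<I>)
        (restrict id ?J ` support (subballean (flat_ballean (point_ballean X \<I>)) ?J))"
      by simp
  qed
  moreover have "coarse_equivalence (subballean (flat_ballean (point_ballean X \<I>)) ?J)
      ?A (restrict id ?J)"
    unfolding coarse_equivalence_def
  proof
    show "coarse_embedding (subballean (flat_ballean (point_ballean X \<I>)) ?J) ?A (restrict id ?J)"
      by (rule coarse_embedding_ideal_at[OF assms]) (use J supp ary in auto)
    have "large_in ?A ?J"
      by (rule large_in_ideal_at[OF assms]) (use J supp ary in auto)
    then show "large_in ?A
        (restrict id ?J ` support (subballean (flat_ballean (point_ballean X \<I>)) ?J))"
      by simp
  qed
  ultimately show ?thesis by blast
qed

end
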